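(* Let $Y_f(t)=\sum_{i=1}^{N_f(t)}X_i$, $t\ge0$, be the generalized fractional compound Poisson process associated with a Bernstein function $f$, a rate $\lambda>0$ and iid jumps $X_i$ with $\mathbb{E}[X_1^2]<\infty$. Then, for $0\le s\le t$: (i) $\mathbb{E}[Y_f(t)]=\lambda\,\mathbb{E}[E_f(t)]\,\mathbb{E}[X_1]$; (ii) $\mathrm{Var}[Y_f(t)]=\lambda\,\mathbb{E}[E_f(t)]\,\mathbb{E}[X_1^2]+\lambda^2(\mathbb{E}[X_1])^2\,\mathrm{Var}[E_f(t)]$; (iii) $\mathrm{Cov}[Y_f(t),Y_f(s)]=\lambda\,\mathbb{E}[X_1^2]\,\mathbb{E}[E_f(s)]+\lambda^2(\mathbb{E}[X_1])^2\,\mathrm{Cov}[E_f(t),E_f(s)]$.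
   Context: Let $f(s)=bs+\int_0^\infty(1-e^{-sx})\,\nu(dx)$, $s>0$, with $b\ge 0$ and $\nu$ a non-negative L\'evy measure on $(0,\infty)$ with $\int_0^\infty (x\wedge 1)\,\nu(dx)<\infty$ and $\nu((0,\infty))=\infty$. Let $\{D_f(t)\}_{t\ge0}$ be the L\'evy subordinator with $\mathbb{E}[e^{-sD_f(t)}]=e^{-tf(s)}$ and $E_f(t)=\inf\{r\ge0: D_f(r)>t\}$ its inverse. Let $\{N(t)\}_{t\ge0}$ be a Poisson process with rate $\lambda>0$ independent of $\{E_f(t)\}$, and $N_f(t)=N(E_f(t))$. Let $X_1,X_2,\dots$ be iid real random variables with common distribution $F_X$, independent of $N$ and $E_f$. The generalized fractional compound Poisson process (GFCPP) is $Y_f(t)=\sum_{i=1}^{N_f(t)}X_i$ (empty sum equal to $0$). *)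

theory Defs
  imports "HOL-Probability.Probability"
begin

text \<open>A non-negative Levy measure on \<open>(0,\<infinity>)\<close> is encoded as a Borel measure on
  the real line that does not charge \<open>(-\<infinity>,0]\<close>.\<close>

definition levy_measure :: "real measure \<Rightarrow> bool" where
  "levy_measure \<nu> \<longleftrightarrow>
     sets \<nu> = sets borel \<and> emeasure \<nu> {..0} = 0 \<and>
     (\<integral>\<^sup>+x\<in>{0<..}. ennreal (min x 1) \<partial>\<nu>) < \<infinity>"

definition bernstein_fun :: "real \<Rightarrow> real measure \<Rightarrow> real \<Rightarrow> real" where
  "bernstein_fun b \<nu> s = b * s + (LINT x:{0<..}|\<nu>. 1 - exp (- (s * x)))"

definition independent_increments :: "'a measure \<Rightarrow> (real \<Rightarrow> 'a \<Rightarrow> real) \<Rightarrow> bool" where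
  "independent_increments M Z \<longleftrightarrow>
     (\<forall>(n::nat) \<tau>. 0 \<le> \<tau> 0 \<longrightarrow> (\<forall>i<n. \<tau> i \<le> \<tau> (Suc i)) \<longrightarrow>
        prob_space.indep_vars M (\<lambda>_. borel) (\<lambda>i \<omega>. Z (\<tau> (Suc i)) \<omega> - Z (\<tau> i) \<omega>) {..<n})"

text \<open>A Levy subordinator with Laplace exponent \<open>f\<close>. Left limits exist by monotonicity, and
  stochastic continuity follows from right-continuity and stationarity of the increments, so
  neither is listed.\<close>

definition levy_subordinator ::
    "'a measure \<Rightarrow> (real \<Rightarrow> real) \<Rightarrow> (real \<Rightarrow> 'a \<Rightarrow> real) \<Rightarrow> bool" where
  "levy_subordinator M f D \<longleftrightarrow>
     (\<forall>t\<ge>0. D t \<in> borel_measurable M) \<and>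
     (AE \<omega> in M. D 0 \<omega> = 0 \<and> mono_on {0..} (\<lambda>t. D t \<omega>) \<and>
        (\<forall>t\<ge>0. continuous (at_right t) (\<lambda>u. D u \<omega>))) \<and>
     independent_increments M D \<and>
     (\<forall>s\<ge>0. \<forall>h\<ge>0. distr M borel (\<lambda>\<omega>. D (s + h) \<omega> - D s \<omega>) = distr M borel (D h)) \<and>
     (\<forall>s>0. \<forall>t\<ge>0. prob_space.expectation M (\<lambda>\<omega>. exp (- (s * D t \<omega>))) = exp (- (t * f s)))"

text \<open>The infimum is formed in \<open>[0,\<infinity>]\<close>. It is infinite when the level \<open>t\<close> is never passed;
  \<open>enn2real\<close> then returns the value 0. For an unbounded subordinator this only
  happens on a null set.\<close>

definition inverse_subordinator :: "(real \<Rightarrow> 'a \<Rightarrow> real) \<Rightarrow> real \<Rightarrow> 'a \<Rightarrow> real" where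
  "inverse_subordinator D t \<omega> = enn2real (INF r\<in>{r. 0 \<le> r \<and> D r \<omega> > t}. ennreal r)"

text \<open>The path conditions on this counting process hold for every \<open>\<omega>\<close>, not just almost
  surely, so that evaluating it at a random time gives a random variable even if the
  probability space is not complete. The natural number subtraction does not truncate, because
  paths are nondecreasing.\<close>

definition poisson_process :: "'a measure \<Rightarrow> real \<Rightarrow> (real \<Rightarrow> 'a \<Rightarrow> nat) \<Rightarrow> bool" where
  "poisson_process M rate N \<longleftrightarrow>
     (\<forall>t\<ge>0. N t \<in> measurable M (count_space UNIV)) \<and>
     (\<forall>\<omega>\<in>space M. N 0 \<omega> = 0 \<and> mono_on {0..} (\<lambda>t. N t \<omega>) \<and>
        (\<forall>t\<ge>0. continuous (at_right t) (\<lambda>u. real (N u \<omega>)))) \<and>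
     independent_increments M (\<lambda>t \<omega>. real (N t \<omega>)) \<and>
     (\<forall>s\<ge>0. \<forall>t>s. distr M (count_space UNIV) (\<lambda>\<omega>. N t \<omega> - N s \<omega>) =
        measure_pmf (poisson_pmf (rate * (t - s))))"

text \<open>The \<open>\<sigma>\<close>-algebra generated by the family \<open>(Z i)\<close>, \<open>i \<in> I\<close>, of maps into \<open>S\<close>.\<close>

definition generated_events ::
    "'a measure \<Rightarrow> 'b measure \<Rightarrow> ('i \<Rightarrow> 'a \<Rightarrow> 'b) \<Rightarrow> 'i set \<Rightarrow> 'a set set" where
  "generated_events M S Z I =
     sigma_sets (space M) (\<Union>i\<in>I. {Z i -` A \<inter> space M | A. A \<in> sets S})"

definition gfcpp ::
    "(real \<Rightarrow> 'a \<Rightarrow> nat) \<Rightarrow> (real \<Rightarrow> 'a \<Rightarrow> real) \<Rightarrow> (nat \<Rightarrow> 'a \<Rightarrow> real) \<Rightarrow> real \<Rightarrow> 'a \<Rightarrow> real" where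
  "gfcpp N E X t \<omega> = (\<Sum>i = 1..N (E t \<omega>) \<omega>. X i \<omega>)"

definition covariance :: "'a measure \<Rightarrow> ('a \<Rightarrow> real) \<Rightarrow> ('a \<Rightarrow> real) \<Rightarrow> real" where
  "covariance M U V = prob_space.expectation M
     (\<lambda>\<omega>. (U \<omega> - prob_space.expectation M U) * (V \<omega> - prob_space.expectation M V))"

end

theory Submission
  imports Defs
begin

text \<open>
  Every expectation is computed by conditioning on the randomness that enters as an index.
  If \<open>A\<close> and \<open>B\<close> are independent sub-\<open>\<sigma>\<close>-algebras, the diagonal map
  \<open>\<omega> \<mapsto> (\<omega>, \<omega>)\<close> pushes the probability measure forward to the product measure on
  \<open>A \<otimes> B\<close>, so by Fubini a functional of the form \<open>\<phi> \<omega> \<omega>\<close> may be integrated with its two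
  arguments decoupled. With \<open>A\<close> generated by the jumps and \<open>B\<close> by \<open>(N, E)\<close> this
  gives Wald-type formulas for random sums; with \<open>A\<close> generated by \<open>N\<close> and \<open>B\<close> by
  \<open>E\<close> it expresses the moments of \<open>N (E t)\<close> through those of \<open>E t\<close>. Joint measurability
  in the second case comes from right-continuity of the Poisson paths.

  Square integrability of \<open>E t\<close> follows from its exponential tail: by Chernoff's bound
  \<open>P(E t > r) \<le> P(D r \<le> t) \<le> exp (t - r f(1))\<close>, and \<open>f(1) > 0\<close> as the Levy measure does not vanish.
\<close>

subsection \<open>Decoupling independent \<open>\<sigma>\<close>-algebras\<close>

text \<open>\<open>generated_events\<close> is already a \<sigma>-algebra, so \<open>sigma\<close>
  adds no sets; it only packages the family as a measure object that can enter product measures and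
  measurability statements.\<close>

lemma sets_sigma_generated_events:
  "sets (sigma (space M) (generated_events M S Z I)) = generated_events M S Z I"
proof -
  have gen: "(\<Union>i\<in>I. {Z i -` A \<inter> space M | A. A \<in> sets S}) \<subseteq> Pow (space M)"
    by auto
  then have "generated_events M S Z I \<subseteq> Pow (space M)"
    unfolding generated_events_def by (meson PowI sigma_sets_into_sp subsetI)
  then show ?thesis
    by (simp only: generated_events_def sigma_sets_sigma_sets_eq[OF gen] sets_measure_of)
qed

lemma measurable_generated_events:
  assumes "i \<in> I" "Z i \<in> space M \<rightarrow> space S"
  shows "Z i \<in> measurable (sigma (space M) (generated_events M S Z I)) S"
proof (rule measurableI)
  fix A assume "A \<in> sets S"
  then have "Z i -` A \<inter> space M \<in> generated_events M S Z I"
    unfolding generated_events_def using assms(1) by (intro sigma_sets.Basic) blast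
  then show "Z i -` A \<inter> space (sigma (space M) (generated_events M S Z I))
      \<in> sets (sigma (space M) (generated_events M S Z I))"
    by (simp add: sets_sigma_generated_events space_measure_of_conv)
qed (use assms(2) in \<open>auto simp: space_measure_of_conv\<close>)

text \<open>The identity, read once as a map into \<open>A\<close> and once as a map into
  \<open>B\<close>, generates exactly these two \<sigma>-algebras. Their independence is thus that
  of two random variables, whose joint law is the law of the diagonal map.\<close>

lemma (in prob_space) distr_diagonal_indep:
  assumes "indep_set (sets A) (sets B)" "space A = space M" "space B = space M"
  shows "distr M (A \<Otimes>\<^sub>M B) (\<lambda>\<omega>. (\<omega>, \<omega>)) = distr M A (\<lambda>\<omega>. \<omega>) \<Otimes>\<^sub>M distr M B (\<lambda>\<omega>. \<omega>)"
proof -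
  have gen: "sigma_sets (space M) {(\<lambda>\<omega>. \<omega>) -` a \<inter> space M | a. a \<in> sets S} = sets S"
    if "space S = space M" for S
  proof -
    have "{(\<lambda>\<omega>. \<omega>) -` a \<inter> space M | a. a \<in> sets S} = sets S"
      using sets.sets_into_space[of _ S] that by (auto; metis Int_absorb2)
    then show ?thesis
      using sets.sigma_sets_eq[of S] that by simp
  qed
  have "sets A \<subseteq> events" "sets B \<subseteq> events"
    using assms(1) by (auto simp: indep_sets2_eq)
  then have "(\<lambda>\<omega>. \<omega>) \<in> measurable M A" "(\<lambda>\<omega>. \<omega>) \<in> measurable M B"
    using measurable_mono[of A A A M] measurable_mono[of B B B M] assms(2,3)
    by (auto simp: measurable_ident_sets)
  then have "indep_var A (\<lambda>\<omega>. \<omega>) B (\<lambda>\<omega>. \<omega>)"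
    unfolding indep_var_eq gen[OF assms(2)] gen[OF assms(3)] using assms(1) by simp
  then show ?thesis
    unfolding indep_var_distribution_eq by simp
qed

lemma (in prob_space)
  assumes indep: "indep_set (sets A) (sets B)" "space A = space M" "space B = space M"
    and phi: "(\<lambda>(x, y). \<phi> x y) \<in> borel_measurable (A \<Otimes>\<^sub>M B)"
  shows nn_integral_diagonal_indep:
      "(\<integral>\<^sup>+\<omega>. ennreal (\<phi> \<omega> \<omega>) \<partial>M) = (\<integral>\<^sup>+y. \<integral>\<^sup>+x. ennreal (\<phi> x y) \<partial>M \<partial>M)"
    and integral_diagonal_indep:
      "integrable M (\<lambda>\<omega>. \<phi> \<omega> \<omega>) \<Longrightarrow> (\<integral>\<omega>. \<phi> \<omega> \<omega> \<partial>M) = (\<integral>y. \<integral>x. \<phi> x y \<partial>M \<partial>M)"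
    and borel_measurable_diagonal_indep: "(\<lambda>\<omega>. \<phi> \<omega> \<omega>) \<in> borel_measurable M"
proof -
  have "sets A \<subseteq> events" "sets B \<subseteq> events"
    using indep by (auto simp: indep_sets2_eq)
  then have id[measurable]: "(\<lambda>\<omega>. \<omega>) \<in> measurable M A" "(\<lambda>\<omega>. \<omega>) \<in> measurable M B"
    using measurable_mono[of A A A M] measurable_mono[of B B B M] indep(2,3)
    by (auto simp: measurable_ident_sets)
  \<comment> \<open>These are the restrictions of \<open>M\<close> to the two \<sigma>-algebras.
    Fubini is applied to their product, and each iterated integral is then carried back to
    \<open>M\<close>.\<close>
  define A' where "A' = distr M A (\<lambda>\<omega>. \<omega>)"
  define B' where "B' = distr M B (\<lambda>\<omega>. \<omega>)"
  have eq: "distr M (A \<Otimes>\<^sub>M B) (\<lambda>\<omega>. (\<omega>, \<omega>)) = A' \<Otimes>\<^sub>M B'"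
    unfolding A'_def B'_def by (rule distr_diagonal_indep[OF indep])
  interpret A': prob_space A' unfolding A'_def by (rule prob_space_distr) (rule id)
  interpret B': prob_space B' unfolding B'_def by (rule prob_space_distr) (rule id)
  interpret P: pair_sigma_finite A' B' ..
  have [measurable_cong]: "sets A' = sets A" "sets B' = sets B"
    by (simp_all add: A'_def B'_def)
  have sp: "space A' = space M" "space B' = space M"
    by (simp_all add: A'_def B'_def indep)
  note phi[measurable]
  have sec: "(\<lambda>x. \<phi> x y) \<in> borel_measurable A" if "y \<in> space M" for y
    using measurable_compose[OF measurable_Pair2'[of y B A] phi] that indep by simp
  show "(\<lambda>\<omega>. \<phi> \<omega> \<omega>) \<in> borel_measurable M"
    using measurable_compose[OF measurable_Pair[OF id] phi] by simp
  have inner: "(\<integral>\<^sup>+x. ennreal (\<phi> x y) \<partial>A') = (\<integral>\<^sup>+x. ennreal (\<phi> x y) \<partial>M)" if "y \<in> space M" for y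
    unfolding A'_def using sec[OF that] by (subst nn_integral_distr[OF id(1)]) auto
  have "(\<integral>\<^sup>+\<omega>. ennreal (\<phi> \<omega> \<omega>) \<partial>M) =
      (\<integral>\<^sup>+z. ennreal (\<phi> (fst z) (snd z)) \<partial>distr M (A \<Otimes>\<^sub>M B) (\<lambda>\<omega>. (\<omega>, \<omega>)))"
    by (subst nn_integral_distr) auto
  also have "\<dots> = (\<integral>\<^sup>+y. \<integral>\<^sup>+x. ennreal (\<phi> x y) \<partial>A' \<partial>B')"
    unfolding eq by (subst P.nn_integral_snd[symmetric]) (auto simp: case_prod_beta)
  also have "\<dots> = (\<integral>\<^sup>+y. \<integral>\<^sup>+x. ennreal (\<phi> x y) \<partial>M \<partial>B')"
    by (intro nn_integral_cong inner) (simp add: sp)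
  also have "\<dots> = (\<integral>\<^sup>+y. \<integral>\<^sup>+x. ennreal (\<phi> x y) \<partial>M \<partial>M)"
  proof -
    \<comment> \<open>Passing from \<open>B'\<close> to \<open>M\<close> needs the inner integral to
      be measurable for the smaller \<open>B\<close>. This is known for the integral over
      \<open>A'\<close>, which agrees with the one over \<open>M\<close> at every point of the
      space.\<close>
    have "(\<lambda>y. \<integral>\<^sup>+x. ennreal (\<phi> x y) \<partial>A') \<in> borel_measurable B"
      by measurable
    then have "(\<lambda>y. \<integral>\<^sup>+x. ennreal (\<phi> x y) \<partial>M) \<in> borel_measurable B"
      by (rule measurable_cong[THEN iffD1, rotated]) (simp add: inner indep)
    then show ?thesis
      unfolding B'_def by (subst nn_integral_distr[OF id(2)]) auto
  qed
  finally show "(\<integral>\<^sup>+\<omega>. ennreal (\<phi> \<omega> \<omega>) \<partial>M) = (\<integral>\<^sup>+y. \<integral>\<^sup>+x. ennreal (\<phi> x y) \<partial>M \<partial>M)" .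
  show "(\<integral>\<omega>. \<phi> \<omega> \<omega> \<partial>M) = (\<integral>y. \<integral>x. \<phi> x y \<partial>M \<partial>M)" if int: "integrable M (\<lambda>\<omega>. \<phi> \<omega> \<omega>)"
  proof -
    have inner: "(\<integral>x. \<phi> x y \<partial>A') = (\<integral>x. \<phi> x y \<partial>M)" if "y \<in> space M" for y
      unfolding A'_def using sec[OF that] by (subst integral_distr[OF id(1)]) auto
    have "integrable (distr M (A \<Otimes>\<^sub>M B) (\<lambda>\<omega>. (\<omega>, \<omega>))) (\<lambda>(x, y). \<phi> x y)"
      using int by (subst integrable_distr_eq) auto
    then have int': "integrable (A' \<Otimes>\<^sub>M B') (\<lambda>(x, y). \<phi> x y)"
      unfolding eq .
    have "(\<integral>\<omega>. \<phi> \<omega> \<omega> \<partial>M) = (\<integral>z. (\<lambda>(x, y). \<phi> x y) z \<partial>distr M (A \<Otimes>\<^sub>M B) (\<lambda>\<omega>. (\<omega>, \<omega>)))"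
      by (subst integral_distr) auto
    also have "\<dots> = (\<integral>y. \<integral>x. \<phi> x y \<partial>A' \<partial>B')"
      unfolding eq using P.integral_snd[OF int'] by simp
    also have "\<dots> = (\<integral>y. \<integral>x. \<phi> x y \<partial>M \<partial>B')"
      by (intro Bochner_Integration.integral_cong inner) (simp_all add: sp)
    also have "\<dots> = (\<integral>y. \<integral>x. \<phi> x y \<partial>M \<partial>M)"
    proof -
      have "(\<lambda>y. \<integral>x. \<phi> x y \<partial>A') \<in> borel_measurable B"
        by measurable
      then have "(\<lambda>y. \<integral>x. \<phi> x y \<partial>M) \<in> borel_measurable B"
        by (rule measurable_cong[THEN iffD1, rotated]) (simp add: inner indep)
      then show ?thesis
        unfolding B'_def by (subst integral_distr[OF id(2)]) auto
    qed
    finally show ?thesis .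
  qed
qed

section \<open>Right-continuous processes at random times\<close>

text \<open>The random time is approximated from above by times in a countable grid, where
  measurability can be checked value by value; right-continuity identifies the limit. The spaces
  \<open>P\<close> and \<open>Q\<close> are kept apart so that the process may live on one
  coordinate of a product.\<close>

lemma borel_measurable_right_continuous_process:
  fixes Z :: "real \<Rightarrow> 'b \<Rightarrow> real"
  assumes Z: "\<And>u. 0 \<le> u \<Longrightarrow> Z u \<in> borel_measurable P"
    and cont: "\<And>\<omega> u. \<omega> \<in> space P \<Longrightarrow> 0 \<le> u \<Longrightarrow> continuous (at_right u) (\<lambda>v. Z v \<omega>)"
    and g[measurable]: "g \<in> borel_measurable Q" and g_nonneg: "\<And>x. x \<in> space Q \<Longrightarrow> 0 \<le> g x"
    and h: "h \<in> measurable Q P"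
  shows "(\<lambda>x. Z (g x) (h x)) \<in> borel_measurable Q"
proof -
  \<comment> \<open>\<open>d n x\<close> is the first multiple of \<open>1 / real (Suc n)\<close>
    strictly above \<open>g x\<close>. Strictness matters, since \<open>at_right\<close> excludes
    the point itself.\<close>
  define d where "d n x = (real (nat \<lfloor>real (Suc n) * g x\<rfloor>) + 1) / real (Suc n)" for n x
  have d: "g x < d n x" "d n x \<le> g x + 1 / real (Suc n)" if "x \<in> space Q" for n x
  proof -
    have "real (nat \<lfloor>real (Suc n) * g x\<rfloor>) = real_of_int \<lfloor>real (Suc n) * g x\<rfloor>"
      using g_nonneg[OF that] by simp
    moreover have "real (Suc n) * d n x = real (nat \<lfloor>real (Suc n) * g x\<rfloor>) + 1"
      by (simp add: d_def)
    moreover have "real (Suc n) * (g x + 1 / real (Suc n)) = real (Suc n) * g x + 1"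
      by (simp add: distrib_left)
    ultimately have "real (Suc n) * g x < real (Suc n) * d n x"
      "real (Suc n) * d n x \<le> real (Suc n) * (g x + 1 / real (Suc n))"
      by linarith+
    then show "g x < d n x" "d n x \<le> g x + 1 / real (Suc n)"
      using mult_less_cancel_left_pos[of "real (Suc n)"] mult_le_cancel_left_pos[of "real (Suc n)"]
      by simp_all
  qed
  show ?thesis
  proof (rule borel_measurable_LIMSEQ_real)
    fix n
    have "(\<lambda>x. Z ((real k + 1) / real (Suc n)) (h x)) \<in> borel_measurable Q" for k :: nat
      by (rule measurable_compose[OF h Z]) simp
    moreover have "(\<lambda>x. \<lfloor>real (Suc n) * g x\<rfloor>) \<in> measurable Q (count_space UNIV)"
      by (rule measurable_compose[OF _ measurable_real_floor]) (intro borel_measurable_times borel_measurable_const g)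
    then have "(\<lambda>x. nat \<lfloor>real (Suc n) * g x\<rfloor>) \<in> measurable Q (count_space UNIV)"
      by (rule measurable_compose) simp
    ultimately show "(\<lambda>x. Z (d n x) (h x)) \<in> borel_measurable Q"
      unfolding d_def by (intro measurable_compose_countable
          [where f = "\<lambda>k x. Z ((real k + 1) / real (Suc n)) (h x)"
            and g = "\<lambda>x. nat \<lfloor>real (Suc n) * g x\<rfloor>"])
  next
    fix x assume x: "x \<in> space Q"
    have "(\<lambda>n. d n x) \<longlonglongrightarrow> g x"
    proof (rule tendsto_sandwich[OF _ _ tendsto_const])
      show "(\<lambda>n. g x + 1 / real (Suc n)) \<longlonglongrightarrow> g x"
        using tendsto_add[OF tendsto_const LIMSEQ_Suc[OF lim_1_over_n], of "g x"] by simp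
      show "\<forall>\<^sub>F n in sequentially. g x \<le> d n x"
        using d(1)[OF x] by (simp add: less_imp_le)
      show "\<forall>\<^sub>F n in sequentially. d n x \<le> g x + 1 / real (Suc n)"
        using d(2)[OF x] by (rule always_eventually[OF allI])
    qed
    then have "filterlim (\<lambda>n. d n x) (at_right (g x)) sequentially"
      using d[OF x] by (auto simp: filterlim_at intro!: always_eventually) (metis less_irrefl)+
    moreover have "((\<lambda>v. Z v (h x)) \<longlongrightarrow> Z (g x) (h x)) (at_right (g x))"
      using cont[OF measurable_space[OF h x] g_nonneg[OF x]] by (simp add: continuous_within)
    ultimately show "(\<lambda>n. Z (d n x) (h x)) \<longlonglongrightarrow> Z (g x) (h x)"
      using filterlim_compose by blast
  qed
qed

subsection \<open>The inverse subordinator\<close>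

text \<open>A discrete layer-cake bound: \<open>(Z \<omega>)\<^sup>2\<close> is dominated by a sum
  of weights over the integers below \<open>Z \<omega>\<close>, so its mean is dominated by a
  weighted sum of tail probabilities.\<close>

lemma (in prob_space) integrable_square_geometric_tail:
  assumes Z[measurable]: "Z \<in> borel_measurable M" and nonneg: "\<And>\<omega>. 0 \<le> Z \<omega>"
    and q: "0 \<le> q" "q < 1" and C: "0 \<le> C"
    and tail: "\<And>n. prob {\<omega> \<in> space M. real n < Z \<omega>} \<le> C * q ^ n"
  shows "integrable M (\<lambda>\<omega>. (Z \<omega>)\<^sup>2)"
proof (rule integrableI_nonneg)
  \<comment> \<open>The sum of these weights over \<open>n < m\<close> is
    \<open>m\<^sup>2 + m\<close>, which dominates \<open>m\<^sup>2\<close>.\<close>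
  define w where "w n = 2 * (real n + 1)" for n
  have w_nonneg: "0 \<le> w n" for n by (simp add: w_def)
  have "ennreal ((Z \<omega>)\<^sup>2) \<le> (\<Sum>n. ennreal (w n) * indicator {\<omega> \<in> space M. real n < Z \<omega>} \<omega>)"
    if "\<omega> \<in> space M" for \<omega>
  proof -
    define m where "m = nat \<lceil>Z \<omega>\<rceil>"
    have "Z \<omega> \<le> real m" unfolding m_def by (rule real_nat_ceiling_ge)
    then have "(Z \<omega>)\<^sup>2 \<le> (real m)\<^sup>2" using nonneg by (intro power_mono) auto
    also have "\<dots> \<le> (\<Sum>n<m. w n)"
    proof -
      have "(\<Sum>n<m. w n) = (real m)\<^sup>2 + real m"
        by (induction m) (auto simp: w_def power2_eq_square algebra_simps)
      then show ?thesis by simp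
    qed
    finally have "ennreal ((Z \<omega>)\<^sup>2) \<le> (\<Sum>n<m. ennreal (w n))"
      using w_nonneg by (simp add: sum_ennreal ennreal_leI)
    also have "\<dots> = (\<Sum>n<m. ennreal (w n) * indicator {\<omega> \<in> space M. real n < Z \<omega>} \<omega>)"
    proof (rule sum.cong)
      fix n assume "n \<in> {..<m}"
      then have "real n < Z \<omega>" by (simp add: m_def) linarith
      then show "ennreal (w n) = ennreal (w n) * indicator {\<omega> \<in> space M. real n < Z \<omega>} \<omega>"
        using that by simp
    qed simp
    also have "\<dots> \<le> (\<Sum>n. ennreal (w n) * indicator {\<omega> \<in> space M. real n < Z \<omega>} \<omega>)"
      by (rule sum_le_suminf) auto
    finally show ?thesis .
  qed
  then have "(\<integral>\<^sup>+\<omega>. ennreal ((Z \<omega>)\<^sup>2) \<partial>M)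
      \<le> (\<integral>\<^sup>+\<omega>. (\<Sum>n. ennreal (w n) * indicator {\<omega> \<in> space M. real n < Z \<omega>} \<omega>) \<partial>M)"
    by (rule nn_integral_mono)
  also have "\<dots> = (\<Sum>n. ennreal (w n * prob {\<omega> \<in> space M. real n < Z \<omega>}))"
    by (simp add: nn_integral_suminf nn_integral_cmult emeasure_eq_measure ennreal_mult w_nonneg)
  also have "\<dots> \<le> (\<Sum>n. ennreal (w n * (C * q ^ n)))"
    by (intro suminf_le ennreal_leI mult_left_mono tail w_nonneg) auto
  also have "\<dots> < \<infinity>"
  proof -
    \<comment> \<open>The weights are linear in \<open>n\<close>, so the series is a multiple of the
      derivative of the geometric series.\<close>
    have "(\<lambda>n. of_nat (Suc n) * q ^ n) sums (1 / (1 - q)\<^sup>2)"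
      using q by (intro geometric_deriv_sums) auto
    then have "summable (\<lambda>n. 2 * C * (of_nat (Suc n) * q ^ n))"
      by (intro summable_mult) (rule sums_summable)
    then have "summable (\<lambda>n. w n * (C * q ^ n))"
      by (rule summable_cong[THEN iffD1, rotated]) (auto simp: w_def algebra_simps)
    then have "(\<Sum>n. ennreal (w n * (C * q ^ n))) \<noteq> \<top>"
      using q C w_nonneg by (intro ennreal_suminf_neq_top) auto
    then show ?thesis by (simp add: less_top)
  qed
  finally show "(\<integral>\<^sup>+\<omega>. ennreal ((Z \<omega>)\<^sup>2) \<partial>M) < \<infinity>" .
qed auto

text \<open>The integrand is strictly positive on a half-line of nonzero mass, so its integral
  cannot vanish. Integrability comes first, because a non-integrable function has integral 0 by
  convention.\<close>

lemma bernstein_fun_pos: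
  assumes "0 \<le> b" "levy_measure \<nu>" "emeasure \<nu> {0<..} = \<infinity>" "0 < u"
  shows "0 < bernstein_fun b \<nu> u"
proof -
  have sets[measurable_cong]: "sets \<nu> = sets borel"
    and fin: "(\<integral>\<^sup>+x\<in>{0<..}. ennreal (min x 1) \<partial>\<nu>) < \<infinity>"
    using assms(2) by (auto simp: levy_measure_def)
  have sp: "space \<nu> = UNIV" using sets_eq_imp_space_eq[OF sets] by simp
  define g where "g x = indicator {0<..} x *\<^sub>R (1 - exp (- (u * x)))" for x :: real
  have g_nonneg: "0 \<le> g x" for x using assms(4) by (auto simp: g_def indicator_def)
  \<comment> \<open>On the half-line the integrand is at most \<open>u * x\<close> and at most 1.
    Both bounds fit under a multiple of \<open>min x 1\<close>, which a Levy measure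
    integrates.\<close>
  have le: "g x \<le> max u 1 * (min x 1 * indicator {0<..} x)" for x
  proof (cases "x > 0")
    case True
    have "1 - exp (- (u * x)) \<le> u * x" using exp_ge_add_one_self[of "- (u * x)"] by linarith
    moreover have "u * x \<le> max u 1 * x" using True by (intro mult_right_mono) auto
    moreover have "1 - exp (- (u * x)) \<le> max u 1"
      using exp_gt_zero[of "- (u * x)"] by linarith
    ultimately have "1 - exp (- (u * x)) \<le> max u 1 * min x 1"
      by (auto simp: min_def)
    then show ?thesis using True by (simp add: g_def)
  qed (simp add: g_def)
  have int: "integrable \<nu> g"
  proof (rule integrableI_nonneg)
    show "g \<in> borel_measurable \<nu>" unfolding g_def by measurable
    have "(\<integral>\<^sup>+x. ennreal (g x) \<partial>\<nu>) \<le> (\<integral>\<^sup>+x. ennreal (max u 1) * (ennreal (min x 1) * indicator {0<..} x) \<partial>\<nu>)"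
    proof (rule nn_integral_mono)
      fix x
      have "ennreal (g x) \<le> ennreal (max u 1 * (min x 1 * indicator {0<..} x))"
        by (rule ennreal_leI[OF le])
      also have "\<dots> = ennreal (max u 1) * (ennreal (min x 1) * indicator {0<..} x)"
        by (auto simp: ennreal_mult' indicator_def)
      finally show "ennreal (g x) \<le> ennreal (max u 1) * (ennreal (min x 1) * indicator {0<..} x)" .
    qed
    also have "\<dots> = ennreal (max u 1) * (\<integral>\<^sup>+x\<in>{0<..}. ennreal (min x 1) \<partial>\<nu>)"
      by (rule nn_integral_cmult) measurable
    also have "\<dots> < \<infinity>" using fin by (simp add: ennreal_mult_less_top)
    finally show "(\<integral>\<^sup>+x. ennreal (g x) \<partial>\<nu>) < \<infinity>" .
  qed (use g_nonneg in auto)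
  have "integral\<^sup>L \<nu> g \<noteq> 0"
  proof
    assume "integral\<^sup>L \<nu> g = 0"
    then have "AE x in \<nu>. g x = 0"
      using integral_nonneg_eq_0_iff_AE[OF int] g_nonneg by auto
    then have "AE x in \<nu>. x \<notin> {0<..}"
      by eventually_elim (use assms(4) in \<open>auto simp: g_def indicator_def split: if_splits\<close>)
    then have "emeasure \<nu> {0<..} = 0"
      by (subst (asm) AE_iff_measurable[of "{0<..}"]) (auto simp: sp)
    with assms(3) show False by simp
  qed
  moreover have "0 \<le> integral\<^sup>L \<nu> g" using g_nonneg by (intro integral_nonneg_AE) auto
  ultimately have "0 < integral\<^sup>L \<nu> g" by simp
  moreover have "bernstein_fun b \<nu> u = b * u + integral\<^sup>L \<nu> g"
    unfolding bernstein_fun_def set_lebesgue_integral_def g_def ..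
  ultimately show ?thesis using assms(1,4) by (simp add: add_nonneg_pos)
qed

lemma inverse_subordinator_nonneg: "0 \<le> inverse_subordinator D t \<omega>"
  by (simp add: inverse_subordinator_def)

text \<open>If \<open>D r \<omega>\<close> exceeded \<open>t\<close>, then \<open>r\<close> would
  compete in the infimum. The default value 0 of \<open>enn2real\<close> does no harm, as no
  nonnegative \<open>r\<close> lies below it.\<close>

lemma inverse_subordinator_greaterD:
  assumes "0 \<le> r" "r < inverse_subordinator D t \<omega>"
  shows "D r \<omega> \<le> t"
proof (rule ccontr)
  assume "\<not> D r \<omega> \<le> t"
  then have "(INF r\<in>{r. 0 \<le> r \<and> D r \<omega> > t}. ennreal r) \<le> ennreal r"
    using assms(1) by (intro INF_lower) auto
  then have "inverse_subordinator D t \<omega> \<le> r"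
    unfolding inverse_subordinator_def using assms(1) by (rule enn2real_leI[rotated])
  then show False using assms(2) by simp
qed

lemma inverse_subordinator_mono:
  assumes "s \<le> t" "0 \<le> r" "t < D r \<omega>"
  shows "inverse_subordinator D s \<omega> \<le> inverse_subordinator D t \<omega>"
  unfolding inverse_subordinator_def
proof (rule enn2real_mono)
  show "(INF r\<in>{r. 0 \<le> r \<and> D r \<omega> > s}. ennreal r) \<le> (INF r\<in>{r. 0 \<le> r \<and> D r \<omega> > t}. ennreal r)"
    using assms(1) by (intro INF_superset_mono) auto
  \<comment> \<open>the level \<open>t\<close> is passed, so \<open>enn2real\<close> is not applied to \<open>\<infinity>\<close>\<close>
  have "(INF r\<in>{r. 0 \<le> r \<and> D r \<omega> > t}. ennreal r) \<le> ennreal r"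
    using assms by (intro INF_lower) auto
  then show "(INF r\<in>{r. 0 \<le> r \<and> D r \<omega> > t}. ennreal r) < \<top>"
    using ennreal_less_top order_le_less_trans by blast
qed

text \<open>Markov's inequality for \<open>exp (- D r \<omega>)\<close>, whose mean is the Laplace
  transform at argument 1.\<close>

lemma (in prob_space) levy_subordinator_small_prob:
  assumes "levy_subordinator M f D" "0 \<le> r"
  shows "prob {\<omega> \<in> space M. D r \<omega> \<le> t} \<le> exp t * exp (- (r * f 1))"
proof -
  have [measurable]: "D r \<in> borel_measurable M"
    and "expectation (\<lambda>\<omega>. exp (- (1 * D r \<omega>))) = exp (- (r * f 1))"
    using assms unfolding levy_subordinator_def by (simp, blast intro: zero_less_one)
  then have L: "expectation (\<lambda>\<omega>. exp (- D r \<omega>)) = exp (- (r * f 1))"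
    by simp
  \<comment> \<open>A non-integrable function would have expectation 0, but this expectation is an
    exponential and hence positive.\<close>
  have int: "integrable M (\<lambda>\<omega>. exp (- D r \<omega>))"
    using L not_integrable_integral_eq[of M "\<lambda>\<omega>. exp (- D r \<omega>)"] by fastforce
  have "prob {\<omega> \<in> space M. D r \<omega> \<le> t} \<le> prob {\<omega> \<in> space M. exp (- t) \<le> exp (- D r \<omega>)}"
    by (intro finite_measure_mono) auto
  also have "\<dots> \<le> expectation (\<lambda>\<omega>. exp (- D r \<omega>)) / exp (- t)"
    by (rule integral_Markov_inequality_measure[OF int, where A = "space M"]) auto
  also have "\<dots> = exp t * exp (- (r * f 1))"
    using L by (simp add: exp_minus field_simps)
  finally show ?thesis .
qed

lemma (in prob_space) inverse_subordinator_square_integrable: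
  assumes D: "levy_subordinator M f D" and f: "0 < f 1"
    and [measurable]: "inverse_subordinator D t \<in> borel_measurable M"
  shows "integrable M (\<lambda>\<omega>. (inverse_subordinator D t \<omega>)\<^sup>2)"
proof (rule integrable_square_geometric_tail[where q = "exp (- f 1)" and C = "exp t"])
  fix n
  have [measurable]: "D (real n) \<in> borel_measurable M"
    using D by (auto simp: levy_subordinator_def)
  \<comment> \<open>At integer times the small-value bound is a power of \<open>exp (- f 1)\<close>,
    which is below 1, so the tail is geometric.\<close>
  have "prob {\<omega> \<in> space M. real n < inverse_subordinator D t \<omega>} \<le> prob {\<omega> \<in> space M. D (real n) \<omega> \<le> t}"
    by (intro finite_measure_mono) (auto dest: inverse_subordinator_greaterD[rotated])
  also have "\<dots> \<le> exp t * exp (- (real n * f 1))"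
    by (rule levy_subordinator_small_prob[OF D]) simp
  finally show "prob {\<omega> \<in> space M. real n < inverse_subordinator D t \<omega>} \<le> exp t * exp (- f 1) ^ n"
    by (simp add: exp_of_nat_mult[symmetric])
qed (use f in \<open>auto simp: inverse_subordinator_nonneg\<close>)

text \<open>Monotonicity can fail only where the level \<open>t\<close> is never passed, because the
  inverse at \<open>t\<close> then takes the default value 0. Such paths form a null set.\<close>

lemma (in prob_space) inverse_subordinator_AE_mono:
  assumes D: "levy_subordinator M f D" and f: "0 < f 1" and "s \<le> t"
  shows "AE \<omega> in M. inverse_subordinator D s \<omega> \<le> inverse_subordinator D t \<omega>"
proof -
  have [measurable]: "D (real n) \<in> borel_measurable M" for n
    using D by (auto simp: levy_subordinator_def)
  \<comment> \<open>Restricting to integer times leaves countably many conditions, so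
    \<open>B\<close> is an event. Its probability lies below every term of a geometric null
    sequence.\<close>
  define B where "B = {\<omega> \<in> space M. \<forall>n::nat. D (real n) \<omega> \<le> t}"
  have [measurable]: "B \<in> events" unfolding B_def by measurable
  have le: "prob B \<le> exp t * exp (- f 1) ^ n" for n
  proof -
    have "prob B \<le> prob {\<omega> \<in> space M. D (real n) \<omega> \<le> t}"
      by (intro finite_measure_mono) (auto simp: B_def)
    also have "\<dots> \<le> exp t * exp (- (real n * f 1))"
      by (rule levy_subordinator_small_prob[OF D]) simp
    finally show ?thesis by (simp add: exp_of_nat_mult[symmetric])
  qed
  have "(\<lambda>n. exp t * exp (- f 1) ^ n) \<longlonglongrightarrow> exp t * 0"
    using f by (intro tendsto_intros LIMSEQ_realpow_zero) auto
  then have "prob B \<le> exp t * 0"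
    by (rule LIMSEQ_le_const) (use le in auto)
  then have "prob B = 0" by (simp add: measure_le_0_iff)
  then have "AE \<omega> in M. \<omega> \<notin> B" by (simp add: prob_eq_0)
  then show ?thesis
  proof (rule AE_mp, intro AE_I2 impI)
    fix \<omega> assume "\<omega> \<in> space M" "\<omega> \<notin> B"
    then obtain n where "t < D (real n) \<omega>" by (auto simp: B_def not_le)
    then show "inverse_subordinator D s \<omega> \<le> inverse_subordinator D t \<omega>"
      by (intro inverse_subordinator_mono[OF assms(3), of "real n"]) auto
  qed
qed

subsection \<open>Poisson processes at independent random times\<close>

lemma has_bochner_integral_pmf_nat:
  fixes p :: "nat pmf" and g :: "nat \<Rightarrow> real"
  assumes "\<And>k. 0 \<le> g k" "(\<lambda>k. pmf p k * g k) sums c"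
  shows "has_bochner_integral (measure_pmf p) g c"
proof (rule has_bochner_integral_nn_integral)
  show "0 \<le> c"
    using assms by (intro sums_le[OF _ sums_zero assms(2)]) simp
  show "(\<integral>\<^sup>+k. ennreal (g k) \<partial>measure_pmf p) = ennreal c"
    using suminf_ennreal_eq[OF _ assms(2)] assms(1)
    by (simp add: nn_integral_measure_pmf nn_integral_count_space_nat ennreal_mult)
qed (use assms(1) in auto)

lemma
  assumes "0 < (r::real)"
  shows has_bochner_integral_poisson_pmf:
      "has_bochner_integral (poisson_pmf r) real r"
    and has_bochner_integral_poisson_pmf_square:
      "has_bochner_integral (poisson_pmf r) (\<lambda>k. (real k)\<^sup>2) (r + r\<^sup>2)"
proof -
  let ?p = "pmf (poisson_pmf r)"
  have p: "?p k = r ^ k / fact k * exp (- r)" for k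
    using assms by simp
  have "(\<lambda>k. r ^ k / fact k) sums exp r"
    using exp_converges[of r] by (simp add: divide_inverse mult.commute)
  then have p_sums: "?p sums 1"
    using sums_mult2[of "\<lambda>k. r ^ k / fact k" "exp r" "exp (- r)"]
    by (simp add: p[abs_def] exp_minus)
  \<comment> \<open>The \<open>k = 0\<close> terms of both moment series vanish. After the index
    shift the mean becomes \<open>r\<close> times the total mass, and the second moment becomes
    \<open>r\<close> times the sum of the mean and the total mass.\<close>
  have shift: "?p (Suc k) * real (Suc k) = r * ?p k" for k
    by (simp add: p del: of_nat_Suc)
  have mean: "(\<lambda>k. ?p k * real k) sums r"
    using sums_mult[OF p_sums, of r] sums_Suc_iff[of "\<lambda>k. ?p k * real k" r]
    by (simp add: shift del: of_nat_Suc)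
  show "has_bochner_integral (poisson_pmf r) real r"
    by (rule has_bochner_integral_pmf_nat[OF _ mean]) simp
  have "(\<lambda>k. r * (?p k * real k) + r * ?p k) sums (r * r + r * 1)"
    by (intro sums_add sums_mult mean p_sums)
  also have "(\<lambda>k. r * (?p k * real k) + r * ?p k) = (\<lambda>k. ?p (Suc k) * (real (Suc k))\<^sup>2)"
  proof
    fix k
    have "?p (Suc k) * (real (Suc k))\<^sup>2 = (?p (Suc k) * real (Suc k)) * real (Suc k)"
      by (simp add: power2_eq_square)
    also have "\<dots> = r * (?p k * real k) + r * ?p k"
      unfolding shift by (simp add: algebra_simps)
    finally show "r * (?p k * real k) + r * ?p k = ?p (Suc k) * (real (Suc k))\<^sup>2" ..
  qed
  finally have "(\<lambda>k. ?p k * (real k)\<^sup>2) sums (r + r\<^sup>2)"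
    using sums_Suc_iff[of "\<lambda>k. ?p k * (real k)\<^sup>2" "r + r\<^sup>2"]
    by (simp add: power2_eq_square add.commute)
  then show "has_bochner_integral (poisson_pmf r) (\<lambda>k. (real k)\<^sup>2) (r + r\<^sup>2)"
    by (rule has_bochner_integral_pmf_nat[rotated]) simp
qed

lemma has_bochner_integral_distrD:
  fixes f :: "'a \<Rightarrow> 'b::{banach, second_countable_topology}"
  assumes "has_bochner_integral (distr M N g) f x" "g \<in> measurable M N" "f \<in> borel_measurable N"
  shows "has_bochner_integral M (\<lambda>\<omega>. f (g \<omega>)) x"
  using assms by (simp add: has_bochner_integral_iff integrable_distr_eq integral_distr)

lemma poisson_process_mono:
  assumes "poisson_process M rate N" "\<omega> \<in> space M" "0 \<le> u" "u \<le> v"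
  shows "N u \<omega> \<le> N v \<omega>"
  using assms by (auto simp: poisson_process_def intro: mono_onD[where A = "{0..}"])

lemma (in prob_space)
  assumes N: "poisson_process M rate N" and "0 < rate" "0 \<le> u" "u \<le> v"
  shows poisson_process_increment_moment:
      "has_bochner_integral M (\<lambda>\<omega>. real (N v \<omega>) - real (N u \<omega>)) (rate * (v - u))"
    and poisson_process_increment_square_moment:
      "has_bochner_integral M (\<lambda>\<omega>. (real (N v \<omega>) - real (N u \<omega>))\<^sup>2)
         (rate * (v - u) + (rate * (v - u))\<^sup>2)"
proof -
  have [measurable]: "N u \<in> measurable M (count_space UNIV)" "N v \<in> measurable M (count_space UNIV)"
    using assms by (auto simp: poisson_process_def)
  have diff: "real (N v \<omega> - N u \<omega>) = real (N v \<omega>) - real (N u \<omega>)" if "\<omega> \<in> space M" for \<omega>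
    using poisson_process_mono[OF N that assms(3,4)] by (rule of_nat_diff)
  have *: "has_bochner_integral M (\<lambda>\<omega>. real (N v \<omega>) - real (N u \<omega>)) (rate * (v - u)) \<and>
    has_bochner_integral M (\<lambda>\<omega>. (real (N v \<omega>) - real (N u \<omega>))\<^sup>2) (rate * (v - u) + (rate * (v - u))\<^sup>2)"
  \<comment> \<open>\<open>poisson_process\<close> prescribes the law of an increment only over an
    interval of positive length; for \<open>u = v\<close> the increment is 0.\<close>
  proof (cases "u < v")
    case True
    then have pos: "0 < rate * (v - u)" using assms(2) by simp
    have distr: "distr M (count_space UNIV) (\<lambda>\<omega>. N v \<omega> - N u \<omega>) = measure_pmf (poisson_pmf (rate * (v - u)))"
      using N True assms(3) by (auto simp: poisson_process_def)
    have "has_bochner_integral M (\<lambda>\<omega>. real (N v \<omega> - N u \<omega>)) (rate * (v - u))"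
      by (rule has_bochner_integral_distrD[where N = "count_space UNIV" and f = real])
        (use has_bochner_integral_poisson_pmf[OF pos] in \<open>simp_all add: distr\<close>)
    moreover have "has_bochner_integral M (\<lambda>\<omega>. (real (N v \<omega> - N u \<omega>))\<^sup>2)
        (rate * (v - u) + (rate * (v - u))\<^sup>2)"
      by (rule has_bochner_integral_distrD[where N = "count_space UNIV" and f = "\<lambda>k. (real k)\<^sup>2"])
        (use has_bochner_integral_poisson_pmf_square[OF pos] in \<open>simp_all add: distr\<close>)
    ultimately show ?thesis
      by (simp add: diff cong: has_bochner_integral_cong)
  next
    case False
    then show ?thesis using assms(4) by (simp add: has_bochner_integral_zero)
  qed
  then show "has_bochner_integral M (\<lambda>\<omega>. real (N v \<omega>) - real (N u \<omega>)) (rate * (v - u))"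
    "has_bochner_integral M (\<lambda>\<omega>. (real (N v \<omega>) - real (N u \<omega>))\<^sup>2) (rate * (v - u) + (rate * (v - u))\<^sup>2)"
    by auto
qed

lemma (in prob_space)
  assumes N: "poisson_process M rate N" and "0 < rate" "0 \<le> u"
  shows poisson_process_moment: "has_bochner_integral M (\<lambda>\<omega>. real (N u \<omega>)) (rate * u)"
    and poisson_process_square_moment:
      "has_bochner_integral M (\<lambda>\<omega>. (real (N u \<omega>))\<^sup>2) (rate * u + (rate * u)\<^sup>2)"
proof -
  have "N 0 \<omega> = 0" if "\<omega> \<in> space M" for \<omega>
    using N that by (auto simp: poisson_process_def)
  then show "has_bochner_integral M (\<lambda>\<omega>. real (N u \<omega>)) (rate * u)"
    "has_bochner_integral M (\<lambda>\<omega>. (real (N u \<omega>))\<^sup>2) (rate * u + (rate * u)\<^sup>2)"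
    using poisson_process_increment_moment[OF N assms(2) order_refl assms(3)]
      poisson_process_increment_square_moment[OF N assms(2) order_refl assms(3)]
    by (simp_all cong: has_bochner_integral_cong)
qed

text \<open>For \<open>u \<le> v\<close> the product is the square of \<open>N u\<close> plus
  \<open>N u\<close> times the increment from \<open>u\<close> to \<open>v\<close>, and the two
  factors of the latter are independent. The other order follows by symmetry.\<close>

lemma (in prob_space) poisson_process_product_moment:
  assumes N: "poisson_process M rate N" and rate: "0 < rate" and "0 \<le> u" "0 \<le> v"
  shows "has_bochner_integral M (\<lambda>\<omega>. real (N u \<omega>) * real (N v \<omega>))
    (rate * min u v + rate\<^sup>2 * (u * v))"
proof -
  have le: "has_bochner_integral M (\<lambda>\<omega>. real (N u \<omega>) * real (N v \<omega>)) (rate * u + rate\<^sup>2 * (u * v))"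
    if uv: "0 \<le> u" "u \<le> v" for u v
  proof -
    \<comment> \<open>The grid 0, \<open>u\<close>, \<open>v\<close> makes the increments of index 0
      and 1 equal to \<open>N u\<close> and \<open>N v - N u\<close>, the first because
      \<open>N\<close> starts at 0.\<close>
    define \<tau> where "\<tau> = (\<lambda>i::nat. if i = 0 then 0 else if i = 1 then u else v)"
    define Z where "Z = (\<lambda>i \<omega>. real (N (\<tau> (Suc i)) \<omega>) - real (N (\<tau> i) \<omega>))"
    have Z0: "Z 0 \<omega> = real (N u \<omega>)" if "\<omega> \<in> space M" for \<omega>
      using N that by (simp add: Z_def \<tau>_def poisson_process_def)
    have Z1: "Z (Suc 0) = (\<lambda>\<omega>. real (N v \<omega>) - real (N u \<omega>))"
      by (simp add: Z_def \<tau>_def)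
    have Z_mom: "has_bochner_integral M (Z 0) (rate * u)" "has_bochner_integral M (Z 1) (rate * (v - u))"
      using poisson_process_moment[OF N rate uv(1)] poisson_process_increment_moment[OF N rate uv]
      by (simp_all add: Z0 Z1 cong: has_bochner_integral_cong)
    have "indep_vars (\<lambda>_. borel) Z {..<2}"
      using N uv unfolding poisson_process_def independent_increments_def Z_def
      by (elim conjE allE[of _ "2::nat"] allE[of _ \<tau>]) (auto simp: \<tau>_def)
    moreover have "integrable M (Z i)" if "i \<in> {..<2}" for i
      using that Z_mom by (auto simp: less_2_cases_iff has_bochner_integral_iff)
    ultimately have "has_bochner_integral M (\<lambda>\<omega>. \<Prod>i\<in>{..<2}. Z i \<omega>) (\<Prod>i\<in>{..<2}. integral\<^sup>L M (Z i))"
      unfolding has_bochner_integral_iff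
      by (auto intro!: indep_vars_lebesgue_integral indep_vars_integrable)
    then have "has_bochner_integral M (\<lambda>\<omega>. Z 0 \<omega> * Z 1 \<omega>) ((rate * u) * (rate * (v - u)))"
      using Z_mom by (simp add: numeral_2_eq_2 lessThan_Suc mult.commute has_bochner_integral_iff)
    then have "has_bochner_integral M (\<lambda>\<omega>. real (N u \<omega>) * (real (N v \<omega>) - real (N u \<omega>)))
        ((rate * u) * (rate * (v - u)))"
      by (simp add: Z0 Z1 cong: has_bochner_integral_cong)
    from has_bochner_integral_add[OF poisson_process_square_moment[OF N rate uv(1)] this]
    show ?thesis
      by (simp add: power2_eq_square algebra_simps)
  qed
  show ?thesis
  proof (cases "u \<le> v")
    case True
    then show ?thesis using le[OF assms(3) True] by (simp add: min_def)
  next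
    case False
    then show ?thesis using le[OF assms(4), of u] by (simp add: min_def mult.commute)
  qed
qed

text \<open>The form of Fubini in which the moments below are computed: \<open>h\<close> is the
  inner integral with the second argument frozen. Integrability of the diagonal functional is not
  assumed but follows from the integrable bound \<open>g\<close> on the inner absolute
  moments.\<close>

lemma (in prob_space) has_bochner_integral_diagonal_indep:
  fixes \<phi> :: "'a \<Rightarrow> 'a \<Rightarrow> real"
  assumes indep: "indep_set (sets A) (sets B)" "space A = space M" "space B = space M"
    and phi: "(\<lambda>(x, y). \<phi> x y) \<in> borel_measurable (A \<Otimes>\<^sub>M B)"
    and inner: "\<And>y. y \<in> space M \<Longrightarrow> has_bochner_integral M (\<lambda>x. \<phi> x y) (h y)"
    and outer: "has_bochner_integral M h c"
    and bound: "\<And>y. y \<in> space M \<Longrightarrow> (\<integral>x. \<bar>\<phi> x y\<bar> \<partial>M) \<le> g y" "integrable M g"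
  shows "has_bochner_integral M (\<lambda>\<omega>. \<phi> \<omega> \<omega>) c"
proof -
  have "(\<integral>\<^sup>+\<omega>. ennreal \<bar>\<phi> \<omega> \<omega>\<bar> \<partial>M) = (\<integral>\<^sup>+y. \<integral>\<^sup>+x. ennreal \<bar>\<phi> x y\<bar> \<partial>M \<partial>M)"
    using phi by (intro nn_integral_diagonal_indep[OF indep]) (auto simp: case_prod_beta)
  also have "\<dots> \<le> (\<integral>\<^sup>+y. ennreal (g y) \<partial>M)"
  proof (rule nn_integral_mono)
    fix y assume y: "y \<in> space M"
    have "(\<integral>\<^sup>+x. ennreal \<bar>\<phi> x y\<bar> \<partial>M) = ennreal (\<integral>x. \<bar>\<phi> x y\<bar> \<partial>M)"
      using inner[OF y] by (intro nn_integral_eq_integral) (auto simp: has_bochner_integral_iff)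
    then show "(\<integral>\<^sup>+x. ennreal \<bar>\<phi> x y\<bar> \<partial>M) \<le> ennreal (g y)"
      using bound(1)[OF y] by (simp add: ennreal_leI)
  qed
  also have "\<dots> \<le> (\<integral>\<^sup>+y. ennreal (norm (g y)) \<partial>M)"
    by (intro nn_integral_mono ennreal_leI) simp
  also have "\<dots> < \<infinity>"
    using bound(2) by (simp add: integrable_iff_bounded)
  finally have int: "integrable M (\<lambda>\<omega>. \<phi> \<omega> \<omega>)"
    using borel_measurable_diagonal_indep[OF indep phi] by (intro integrableI_bounded) auto
  have "(\<integral>\<omega>. \<phi> \<omega> \<omega> \<partial>M) = (\<integral>y. \<integral>x. \<phi> x y \<partial>M \<partial>M)"
    by (rule integral_diagonal_indep[OF indep phi int])
  also have "\<dots> = integral\<^sup>L M h"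
    using inner by (intro Bochner_Integration.integral_cong) (auto simp: has_bochner_integral_iff)
  finally show ?thesis
    using int outer by (simp add: has_bochner_integral_iff)
qed

lemma abs_mult_le_sum_squares: "\<bar>a * b\<bar> \<le> a\<^sup>2 + b\<^sup>2" for a b :: real
  using sum_squares_bound[of "\<bar>a\<bar>" "\<bar>b\<bar>"] mult_nonneg_nonneg[of "\<bar>a\<bar>" "\<bar>b\<bar>"]
  unfolding abs_mult power2_abs by linarith

lemma integrable_mult_square:
  fixes f g :: "'a \<Rightarrow> real"
  assumes "f \<in> borel_measurable M" "g \<in> borel_measurable M"
    and "integrable M (\<lambda>x. (f x)\<^sup>2)" "integrable M (\<lambda>x. (g x)\<^sup>2)"
  shows "integrable M (\<lambda>x. f x * g x)"
proof (rule Bochner_Integration.integrable_bound)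
  show "integrable M (\<lambda>x. (f x)\<^sup>2 + (g x)\<^sup>2)"
    using assms by simp
  show "AE x in M. norm (f x * g x) \<le> norm ((f x)\<^sup>2 + (g x)\<^sup>2)"
    using abs_mult_le_sum_squares by (auto intro!: AE_I2)
qed (use assms in auto)

text \<open>With \<open>y\<close> frozen, \<open>E t y\<close> and \<open>E s y\<close> are
  deterministic times and the ordinary Poisson moments apply. The minimum of the two times stays in
  the formula because no order between them is available here.\<close>

lemma (in prob_space)
  assumes N: "poisson_process M rate N" and rate: "0 < rate"
    and indep: "indep_set (generated_events M (count_space UNIV) N {0..}) (generated_events M borel E {0..})"
    and E_nonneg: "\<And>r \<omega>. 0 \<le> E r \<omega>" and st: "0 \<le> s" "0 \<le> t"
    and int: "integrable M (\<lambda>\<omega>. (E s \<omega>)\<^sup>2)" "integrable M (\<lambda>\<omega>. (E t \<omega>)\<^sup>2)"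
  shows time_changed_poisson_moment:
      "has_bochner_integral M (\<lambda>\<omega>. real (N (E t \<omega>) \<omega>)) (rate * expectation (E t))"
    and time_changed_poisson_product_moment:
      "has_bochner_integral M (\<lambda>\<omega>. real (N (E t \<omega>) \<omega>) * real (N (E s \<omega>) \<omega>))
         (rate * expectation (\<lambda>\<omega>. min (E t \<omega>) (E s \<omega>)) + rate\<^sup>2 * expectation (\<lambda>\<omega>. E t \<omega> * E s \<omega>))"
proof -
  define A where "A = sigma (space M) (generated_events M (count_space UNIV) N {0..})"
  define B where "B = sigma (space M) (generated_events M borel E {0..})"
  have AB: "indep_set (sets A) (sets B)" "space A = space M" "space B = space M"
    using indep by (simp_all add: A_def B_def sets_sigma_generated_events space_measure_of_conv)
  have N_meas: "N u \<in> measurable A (count_space UNIV)" if "0 \<le> u" for u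
    unfolding A_def using that by (intro measurable_generated_events) auto
  have E_meas[measurable]: "E r \<in> borel_measurable B" if "0 \<le> r" for r
    unfolding B_def using that by (intro measurable_generated_events) auto
  have E_meas_M[measurable]: "E r \<in> borel_measurable M" if "0 \<le> r" for r
    using measurable_mono[of borel borel B M] E_meas[OF that] AB by (auto simp: indep_sets2_eq)
  \<comment> \<open>The process reads the first coordinate and its random time the second, so joint
    measurability is an instance of the grid approximation with \<open>h = fst\<close>.\<close>
  have NE: "(\<lambda>(x, y). real (N (E r y) x)) \<in> borel_measurable (A \<Otimes>\<^sub>M B)" if "0 \<le> r" for r
    unfolding case_prod_beta
  proof (rule borel_measurable_right_continuous_process[where P = A and h = fst and g = "\<lambda>z. E r (snd z)"])
    show "(\<lambda>\<omega>. real (N u \<omega>)) \<in> borel_measurable A" if "0 \<le> u" for u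
      using N_meas[OF that] by (rule measurable_compose) simp
    show "continuous (at_right u) (\<lambda>v. real (N v \<omega>))" if "\<omega> \<in> space A" "0 \<le> u" for \<omega> u
      using N that AB by (simp add: poisson_process_def)
  qed (use E_nonneg that in auto)
  have intE: "integrable M (E t)" "integrable M (E s)"
    using square_integrable_imp_integrable[OF E_meas_M] st int by auto
  have int_min: "integrable M (\<lambda>\<omega>. min (E t \<omega>) (E s \<omega>))"
    using intE by (rule integrable_min)
  have int_mult: "integrable M (\<lambda>\<omega>. E t \<omega> * E s \<omega>)"
    using int st by (intro integrable_mult_square) auto
  show "has_bochner_integral M (\<lambda>\<omega>. real (N (E t \<omega>) \<omega>)) (rate * expectation (E t))"
  proof (rule has_bochner_integral_diagonal_indep[OF AB NE[OF st(2)]])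
    show moment: "has_bochner_integral M (\<lambda>x. real (N (E t y) x)) (rate * E t y)" for y
      by (rule poisson_process_moment[OF N rate E_nonneg])
    \<comment> \<open>The integrand is nonnegative, so the moment itself serves as the bound on the
      absolute moment.\<close>
    show "(\<integral>x. \<bar>real (N (E t y) x)\<bar> \<partial>M) \<le> rate * E t y" for y
      using moment[of y] by (simp add: has_bochner_integral_iff)
  qed (use intE in \<open>auto simp: has_bochner_integral_iff\<close>)
  show "has_bochner_integral M (\<lambda>\<omega>. real (N (E t \<omega>) \<omega>) * real (N (E s \<omega>) \<omega>))
      (rate * expectation (\<lambda>\<omega>. min (E t \<omega>) (E s \<omega>)) + rate\<^sup>2 * expectation (\<lambda>\<omega>. E t \<omega> * E s \<omega>))"
  proof (rule has_bochner_integral_diagonal_indep[OF AB,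
        where \<phi> = "\<lambda>x y. real (N (E t y) x) * real (N (E s y) x)"])
    show "(\<lambda>(x, y). real (N (E t y) x) * real (N (E s y) x)) \<in> borel_measurable (A \<Otimes>\<^sub>M B)"
      using borel_measurable_times[OF NE[OF st(2)] NE[OF st(1)]] by (simp add: case_prod_beta)
    show moment: "has_bochner_integral M (\<lambda>x. real (N (E t y) x) * real (N (E s y) x))
        (rate * min (E t y) (E s y) + rate\<^sup>2 * (E t y * E s y))" for y
      by (rule poisson_process_product_moment[OF N rate E_nonneg E_nonneg])
    show "(\<integral>x. \<bar>real (N (E t y) x) * real (N (E s y) x)\<bar> \<partial>M)
        \<le> rate * min (E t y) (E s y) + rate\<^sup>2 * (E t y * E s y)" for y
      using moment[of y] by (simp add: has_bochner_integral_iff)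
  qed (use int_min int_mult in \<open>auto simp: has_bochner_integral_iff\<close>)
qed

subsection \<open>Random sums\<close>

text \<open>In the double sum for the product, \<open>min k l\<close> index pairs are diagonal and
  contribute the second moment of a jump; independence makes all others contribute the squared
  mean.\<close>

lemma (in prob_space)
  assumes X: "indep_vars (\<lambda>_. borel) X {1..}"
    and ident: "\<And>i. i \<ge> 1 \<Longrightarrow> distr M borel (X i) = F"
    and sq: "integrable M (\<lambda>\<omega>. (X 1 \<omega>)\<^sup>2)"
  shows partial_sum_moment:
      "has_bochner_integral M (\<lambda>\<omega>. \<Sum>i = 1..k::nat. X i \<omega>) (real k * expectation (X 1))"
    and partial_sum_product_moment: "has_bochner_integral M (\<lambda>\<omega>. (\<Sum>i = 1..k. X i \<omega>) * (\<Sum>i = 1..l. X i \<omega>))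
      (real (min k l) * (expectation (\<lambda>\<omega>. (X 1 \<omega>)\<^sup>2) - (expectation (X 1))\<^sup>2)
        + real k * real l * (expectation (X 1))\<^sup>2)"
proof -
  define m where "m = expectation (X 1)"
  define m2 where "m2 = expectation (\<lambda>\<omega>. (X 1 \<omega>)\<^sup>2)"
  have [measurable]: "X i \<in> borel_measurable M" if "1 \<le> i" for i
    using X that by (simp add: indep_vars_def2)
  \<comment> \<open>Equal laws carry integrability and moments from \<open>X 1\<close> to every
    other jump.\<close>
  have transfer: "has_bochner_integral M (\<lambda>\<omega>. h (X i \<omega>)) c"
    if "has_bochner_integral M (\<lambda>\<omega>. h (X 1 \<omega>)) c" "h \<in> borel_measurable borel" "1 \<le> i"
    for h :: "real \<Rightarrow> real" and i c
  proof (rule has_bochner_integral_distrD[where N = borel and f = h])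
    have "distr M borel (X i) = distr M borel (X 1)"
      using ident that(3) by simp
    then show "has_bochner_integral (distr M borel (X i)) h c"
      using has_bochner_integral_distr[OF that(2) _ that(1)] by simp
  qed (use that in simp_all)
  have X1: "has_bochner_integral M (X 1) m"
    using square_integrable_imp_integrable[of "X 1"] sq by (simp add: has_bochner_integral_iff m_def)
  have X2: "has_bochner_integral M (\<lambda>\<omega>. (X 1 \<omega>)\<^sup>2) m2"
    using sq by (simp add: has_bochner_integral_iff m2_def)
  have mean: "has_bochner_integral M (X i) m" if "1 \<le> i" for i
    using transfer[of "\<lambda>x. x", OF _ _ that] X1 by simp
  have prod: "has_bochner_integral M (\<lambda>\<omega>. X i \<omega> * X j \<omega>) (if i = j then m2 else m\<^sup>2)"
    if "1 \<le> i" "1 \<le> j" for i j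
  proof (cases "i = j")
    case True
    then show ?thesis
      using transfer[of "\<lambda>x. x\<^sup>2", OF X2 _ that(1)] by (simp add: power2_eq_square)
  next
    case False
    have "indep_vars (\<lambda>_. borel) X {i, j}"
      using that by (intro indep_vars_subset[OF X]) auto
    moreover have "integrable M (X i')" if "i' \<in> {i, j}" for i'
      using mean that \<open>1 \<le> i\<close> \<open>1 \<le> j\<close> by (auto simp: has_bochner_integral_iff)
    ultimately have "has_bochner_integral M (\<lambda>\<omega>. \<Prod>i'\<in>{i, j}. X i' \<omega>) (\<Prod>i'\<in>{i, j}. expectation (X i'))"
      unfolding has_bochner_integral_iff
      by (auto intro!: indep_vars_lebesgue_integral indep_vars_integrable simp del: prod.insert)
    moreover have "expectation (X i) = m" "expectation (X j) = m"
      using mean that by (auto simp: has_bochner_integral_iff)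
    ultimately show ?thesis
      using False by (simp add: power2_eq_square)
  qed
  have "has_bochner_integral M (\<lambda>\<omega>. \<Sum>i = 1..k. X i \<omega>) (\<Sum>i = 1..k. m)"
    by (intro has_bochner_integral_sum mean) simp
  then show "has_bochner_integral M (\<lambda>\<omega>. \<Sum>i = 1..k. X i \<omega>) (real k * expectation (X 1))"
    by (simp add: m_def)
  have "has_bochner_integral M (\<lambda>\<omega>. \<Sum>i = 1..k. \<Sum>j = 1..l. X i \<omega> * X j \<omega>)
      (\<Sum>i = 1..k. \<Sum>j = 1..l. if i = j then m2 else m\<^sup>2)"
    by (intro has_bochner_integral_sum prod) simp_all
  \<comment> \<open>Every pair is charged \<open>m\<^sup>2\<close>, and a diagonal pair also the
    excess \<open>m2 - m\<^sup>2\<close>, the variance of a jump; what remains is to count the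
    diagonal.\<close>
  also have "(\<Sum>i = 1..k. \<Sum>j = 1..l. if i = j then m2 else m\<^sup>2)
      = (\<Sum>i = 1..k. \<Sum>j = 1..l. m\<^sup>2 + (if i = j then m2 - m\<^sup>2 else 0))"
    by (intro sum.cong) auto
  also have "\<dots> = real k * real l * m\<^sup>2 + (\<Sum>i = 1..k. if i \<in> {1..l} then m2 - m\<^sup>2 else 0)"
    by (simp add: sum.distrib)
  also have "(\<Sum>i = 1..k. if i \<in> {1..l} then m2 - m\<^sup>2 else 0) = (\<Sum>i\<in>{1..k} \<inter> {1..l}. m2 - m\<^sup>2)"
    by (rule sum.inter_restrict[symmetric]) simp
  also have "\<dots> = real (min k l) * (m2 - m\<^sup>2)"
    by simp
  finally show "has_bochner_integral M (\<lambda>\<omega>. (\<Sum>i = 1..k. X i \<omega>) * (\<Sum>i = 1..l. X i \<omega>))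
      (real (min k l) * (expectation (\<lambda>\<omega>. (X 1 \<omega>)\<^sup>2) - (expectation (X 1))\<^sup>2)
        + real k * real l * (expectation (X 1))\<^sup>2)"
    by (simp add: sum_product m_def m2_def add.commute)
qed

text \<open>Freezing the counts reduces both claims to sums of fixed length. The counts need only be
  measurable for some \<open>B\<close> independent of the jumps, which allows a Poisson process at a
  random time.\<close>

lemma (in prob_space)
  fixes K L :: "'a \<Rightarrow> nat"
  assumes X: "indep_vars (\<lambda>_. borel) X {1..}"
    and ident: "\<And>i. i \<ge> 1 \<Longrightarrow> distr M borel (X i) = F"
    and sq: "integrable M (\<lambda>\<omega>. (X 1 \<omega>)\<^sup>2)"
    and indep: "indep_set (generated_events M borel X {1..}) (sets B)" "space B = space M"
    and K[measurable]: "K \<in> measurable B (count_space UNIV)" "L \<in> measurable B (count_space UNIV)"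
    and int: "integrable M (\<lambda>\<omega>. (real (K \<omega>))\<^sup>2)" "integrable M (\<lambda>\<omega>. (real (L \<omega>))\<^sup>2)"
  shows random_sum_moment:
      "has_bochner_integral M (\<lambda>\<omega>. \<Sum>i = 1..K \<omega>. X i \<omega>) (expectation (\<lambda>\<omega>. real (K \<omega>)) * expectation (X 1))"
    and random_sum_product_moment:
      "has_bochner_integral M (\<lambda>\<omega>. (\<Sum>i = 1..K \<omega>. X i \<omega>) * (\<Sum>i = 1..L \<omega>. X i \<omega>))
         (expectation (\<lambda>\<omega>. real (min (K \<omega>) (L \<omega>))) * (expectation (\<lambda>\<omega>. (X 1 \<omega>)\<^sup>2) - (expectation (X 1))\<^sup>2)
          + expectation (\<lambda>\<omega>. real (K \<omega>) * real (L \<omega>)) * (expectation (X 1))\<^sup>2)"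
proof -
  define A where "A = sigma (space M) (generated_events M borel X {1..})"
  have AB: "indep_set (sets A) (sets B)" "space A = space M" "space B = space M"
    using indep by (simp_all add: A_def sets_sigma_generated_events space_measure_of_conv)
  define m where "m = expectation (X 1)"
  define v where "v = expectation (\<lambda>\<omega>. (X 1 \<omega>)\<^sup>2) - m\<^sup>2"
  define S where "S k \<omega> = (\<Sum>i = 1..k. X i \<omega>)" for k \<omega>
  note S_mean = partial_sum_moment[OF X ident sq, folded m_def, folded v_def S_def]
    and S_prod = partial_sum_product_moment[OF X ident sq, folded m_def, folded v_def S_def]
  have X_meas[measurable]: "X i \<in> borel_measurable A" if "1 \<le> i" for i
    unfolding A_def using that by (intro measurable_generated_events) auto
  have S_meas: "S k \<in> borel_measurable A" for k
    unfolding S_def by (intro borel_measurable_sum X_meas) simp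
  have "sets B \<subseteq> events"
    using AB by (auto simp: indep_sets2_eq)
  then have [measurable]: "K \<in> measurable M (count_space UNIV)" "L \<in> measurable M (count_space UNIV)"
    using measurable_mono[of "count_space UNIV" "count_space UNIV" B M] K AB by auto
  \<comment> \<open>\<open>J\<close> takes countably many values, so measurability is checked with
    the length of the sum held fixed.\<close>
  have SK: "(\<lambda>(x, y). S (J y) x) \<in> borel_measurable (A \<Otimes>\<^sub>M B)"
    if [measurable]: "J \<in> measurable B (count_space UNIV)" for J :: "'a \<Rightarrow> nat"
    unfolding case_prod_beta
  proof (rule measurable_compose_countable[where f = "\<lambda>k z. S k (fst z)" and g = "\<lambda>z. J (snd z)"])
    show "(\<lambda>z. S k (fst z)) \<in> borel_measurable (A \<Otimes>\<^sub>M B)" for k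
      by (rule measurable_compose[OF measurable_fst S_meas])
  qed measurable
  have K_int: "integrable M (\<lambda>\<omega>. real (K \<omega>))" "integrable M (\<lambda>\<omega>. real (L \<omega>))"
    using int by (auto intro!: square_integrable_imp_integrable)
  have KL_int: "integrable M (\<lambda>\<omega>. real (K \<omega>) * real (L \<omega>))"
    using int by (intro integrable_mult_square) auto
  have min_int: "integrable M (\<lambda>\<omega>. real (min (K \<omega>) (L \<omega>)))"
    using integrable_min[OF K_int] by (simp add: of_nat_min)
  \<comment> \<open>\<open>V k\<close> is the second moment of \<open>S k\<close>, with
    \<open>v\<close> the variance of a jump. It is quadratic in \<open>k\<close>, so square
    integrable counts make it integrable along them, as the bounds below require.\<close>
  define V where "V k = real k * v + (real k)\<^sup>2 * m\<^sup>2" for k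
  have S_square: "has_bochner_integral M (\<lambda>\<omega>. (S k \<omega>)\<^sup>2) (V k)" for k
    using S_prod[of k k] by (simp add: V_def power2_eq_square)
  have V_int: "integrable M (\<lambda>\<omega>. V (K \<omega>))" "integrable M (\<lambda>\<omega>. V (L \<omega>))"
    unfolding V_def using K_int int by auto
  have "has_bochner_integral M (\<lambda>\<omega>. S (K \<omega>) \<omega>) (expectation (\<lambda>\<omega>. real (K \<omega>)) * m)"
  proof (rule has_bochner_integral_diagonal_indep[OF AB SK[OF K(1)]])
    show "has_bochner_integral M (\<lambda>x. S (K y) x) (real (K y) * m)" for y
      by (rule S_mean)
    \<comment> \<open>Jumps may have either sign, so the absolute moment is not given by
      \<open>S_mean\<close>; it is controlled by
      \<open>\<bar>x\<bar> \<le> 1 + x\<^sup>2\<close>.\<close>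
    show "(\<integral>x. \<bar>S (K y) x\<bar> \<partial>M) \<le> 1 + V (K y)" for y
    proof -
      have "(\<integral>x. \<bar>S (K y) x\<bar> \<partial>M) \<le> (\<integral>x. 1 + (S (K y) x)\<^sup>2 \<partial>M)"
        using S_mean[of "K y"] S_square[of "K y"] abs_mult_le_sum_squares[of 1]
        by (intro integral_mono) (auto simp: has_bochner_integral_iff)
      also have "\<dots> = 1 + V (K y)"
        using S_square[of "K y"] by (simp add: has_bochner_integral_iff prob_space)
      finally show ?thesis .
    qed
  qed (use K_int V_int in \<open>auto simp: has_bochner_integral_iff\<close>)
  then show "has_bochner_integral M (\<lambda>\<omega>. \<Sum>i = 1..K \<omega>. X i \<omega>)
      (expectation (\<lambda>\<omega>. real (K \<omega>)) * expectation (X 1))"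
    by (simp add: S_def m_def)
  have "has_bochner_integral M (\<lambda>\<omega>. S (K \<omega>) \<omega> * S (L \<omega>) \<omega>)
      (expectation (\<lambda>\<omega>. real (min (K \<omega>) (L \<omega>))) * v + expectation (\<lambda>\<omega>. real (K \<omega>) * real (L \<omega>)) * m\<^sup>2)"
  proof (rule has_bochner_integral_diagonal_indep[OF AB, where \<phi> = "\<lambda>x y. S (K y) x * S (L y) x"])
    show "(\<lambda>(x, y). S (K y) x * S (L y) x) \<in> borel_measurable (A \<Otimes>\<^sub>M B)"
      using borel_measurable_times[OF SK[OF K(1)] SK[OF K(2)]] by (simp add: case_prod_beta)
    show "has_bochner_integral M (\<lambda>x. S (K y) x * S (L y) x)
        (real (min (K y) (L y)) * v + real (K y) * real (L y) * m\<^sup>2)" for y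
      by (rule S_prod)
    show "(\<integral>x. \<bar>S (K y) x * S (L y) x\<bar> \<partial>M) \<le> V (K y) + V (L y)" for y
    proof -
      have "(\<integral>x. \<bar>S (K y) x * S (L y) x\<bar> \<partial>M) \<le> (\<integral>x. (S (K y) x)\<^sup>2 + (S (L y) x)\<^sup>2 \<partial>M)"
        using S_prod[of "K y" "L y"] S_square[of "K y"] S_square[of "L y"] abs_mult_le_sum_squares
        by (intro integral_mono) (auto simp: has_bochner_integral_iff)
      also have "\<dots> = V (K y) + V (L y)"
        using S_square[of "K y"] S_square[of "L y"] by (simp add: has_bochner_integral_iff)
      finally show ?thesis .
    qed
  qed (use min_int KL_int V_int in \<open>auto simp: has_bochner_integral_iff simp del: of_nat_min\<close>)
  then show "has_bochner_integral M (\<lambda>\<omega>. (\<Sum>i = 1..K \<omega>. X i \<omega>) * (\<Sum>i = 1..L \<omega>. X i \<omega>))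
         (expectation (\<lambda>\<omega>. real (min (K \<omega>) (L \<omega>))) * (expectation (\<lambda>\<omega>. (X 1 \<omega>)\<^sup>2) - (expectation (X 1))\<^sup>2)
          + expectation (\<lambda>\<omega>. real (K \<omega>) * real (L \<omega>)) * (expectation (X 1))\<^sup>2)"
    by (simp add: S_def m_def v_def)
qed

section \<open>Mean, variance and covariance of the compound process\<close>

lemma (in prob_space) covariance_eq:
  fixes U V :: "'a \<Rightarrow> real"
  assumes "integrable M U" "integrable M V" "integrable M (\<lambda>\<omega>. U \<omega> * V \<omega>)"
  shows "covariance M U V = expectation (\<lambda>\<omega>. U \<omega> * V \<omega>) - expectation U * expectation V"
proof -
  have "covariance M U V = expectation (\<lambda>\<omega>. U \<omega> * V \<omega> - expectation V * U \<omega> - expectation U * V \<omega>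
      + expectation U * expectation V)"
    unfolding covariance_def by (intro Bochner_Integration.integral_cong) (auto simp: algebra_simps)
  also have "\<dots> = expectation (\<lambda>\<omega>. U \<omega> * V \<omega>) - expectation U * expectation V"
    using assms by (simp add: prob_space)
  finally show ?thesis .
qed

text \<open>Integrability is part of the conclusion because a non-integrable function has
  expectation 0 by convention, so the moment identities alone would not say that the moments
  exist.\<close>

theorem theorem3p2:
  fixes M :: "'a measure"
    and b rate s t :: real
    and \<nu> F\<^sub>X :: "real measure"
    and f :: "real \<Rightarrow> real"
    and D E Y :: "real \<Rightarrow> 'a \<Rightarrow> real"
    and N :: "real \<Rightarrow> 'a \<Rightarrow> nat"
    and X :: "nat \<Rightarrow> 'a \<Rightarrow> real"
  assumes "prob_space M"
    and "b \<ge> 0" and "levy_measure \<nu>" and "emeasure \<nu> {0<..} = \<infinity>"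
    and "\<And>u. u > 0 \<Longrightarrow> f u = bernstein_fun b \<nu> u"
    and "levy_subordinator M f D"
    and "E = inverse_subordinator D"
    and "rate > 0" and "poisson_process M rate N"
    and "prob_space.indep_set M
           (generated_events M (count_space UNIV) N {0..}) (generated_events M borel E {0..})"
    and "prob_space.indep_vars M (\<lambda>_. borel) X {1..}"
    and "\<And>i. i \<ge> 1 \<Longrightarrow> distr M borel (X i) = F\<^sub>X"
    and "prob_space.indep_set M (generated_events M borel X {1..})
           (sigma_sets (space M)
             (generated_events M (count_space UNIV) N {0..} \<union> generated_events M borel E {0..}))"
    and "integrable M (\<lambda>\<omega>. (X 1 \<omega>)\<^sup>2)"
    and "Y = gfcpp N E X"
    and "0 \<le> s" and "s \<le> t"
  shows
    "integrable M (E t) \<and> integrable M (\<lambda>\<omega>. (E t \<omega>)\<^sup>2) \<and>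
     integrable M (Y t) \<and> integrable M (\<lambda>\<omega>. (Y t \<omega>)\<^sup>2) \<and>
     prob_space.expectation M (Y t) =
       rate * prob_space.expectation M (E t) * prob_space.expectation M (X 1) \<and>
     prob_space.variance M (Y t) =
       rate * prob_space.expectation M (E t) * prob_space.expectation M (\<lambda>\<omega>. (X 1 \<omega>)\<^sup>2)
       + rate\<^sup>2 * (prob_space.expectation M (X 1))\<^sup>2 * prob_space.variance M (E t) \<and>
     covariance M (Y t) (Y s) =
       rate * prob_space.expectation M (\<lambda>\<omega>. (X 1 \<omega>)\<^sup>2) * prob_space.expectation M (E s)
       + rate\<^sup>2 * (prob_space.expectation M (X 1))\<^sup>2 * covariance M (E t) (E s)"
proof -
  interpret prob_space M by fact
  note D = \<open>levy_subordinator M f D\<close> and E_def = \<open>E = inverse_subordinator D\<close>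
    and N = \<open>poisson_process M rate N\<close> and rate = \<open>rate > 0\<close>
    and X = \<open>indep_vars (\<lambda>_. borel) X {1..}\<close>
    and X_sq = \<open>integrable M (\<lambda>\<omega>. (X 1 \<omega>)\<^sup>2)\<close>
    and NE_indep = \<open>indep_set (generated_events M (count_space UNIV) N {0..}) (generated_events M borel E {0..})\<close>
  have f1: "0 < f 1"
    using bernstein_fun_pos[of b \<nu> 1] assms(2-5) by simp
  \<comment> \<open>The jumps are independent of \<open>N\<close> and \<open>E\<close> jointly;
    \<open>B\<close> carries both, so that the count \<open>N (E r \<omega>) \<omega>\<close> is
    measurable for it.\<close>
  define B where "B = sigma (space M)
    (generated_events M (count_space UNIV) N {0..} \<union> generated_events M borel E {0..})"
  \<comment> \<open>Independence of two families includes that their members are events. This is the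
    source of the measurability of \<open>E r\<close> with respect to \<open>M\<close>.\<close>
  have gen_sub: "generated_events M (count_space UNIV) N {0..} \<union> generated_events M borel E {0..} \<subseteq> events"
    using NE_indep by (auto simp: indep_sets2_eq)
  have sets_B: "sets B = sigma_sets (space M)
      (generated_events M (count_space UNIV) N {0..} \<union> generated_events M borel E {0..})"
    unfolding B_def using gen_sub sets.space_closed by (intro sets_measure_of) blast
  have space_B: "space B = space M"
    by (simp add: B_def space_measure_of_conv)
  have B_events: "sets B \<subseteq> events"
    unfolding sets_B using gen_sub by (rule sets.sigma_sets_subset)
  have N_B: "N u \<in> measurable B (count_space UNIV)" if "0 \<le> u" for u
  proof (rule measurable_mono[THEN subsetD, OF order_refl refl])
    show "N u \<in> measurable (sigma (space M) (generated_events M (count_space UNIV) N {0..})) (count_space UNIV)"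
      using that by (intro measurable_generated_events) auto
  qed (auto simp: sets_sigma_generated_events sets_B space_B space_measure_of_conv)
  have E_B: "E r \<in> borel_measurable B" if "0 \<le> r" for r
  proof (rule measurable_mono[THEN subsetD, OF order_refl refl])
    show "E r \<in> borel_measurable (sigma (space M) (generated_events M borel E {0..}))"
      using that by (intro measurable_generated_events) auto
  qed (auto simp: sets_sigma_generated_events sets_B space_B space_measure_of_conv)
  have E_nonneg: "0 \<le> E r \<omega>" for r \<omega>
    by (simp add: E_def inverse_subordinator_nonneg)
  have NE_B: "(\<lambda>\<omega>. N (E r \<omega>) \<omega>) \<in> measurable B (count_space UNIV)" if "0 \<le> r" for r
  proof -
    have "(\<lambda>\<omega>. real (N (E r \<omega>) \<omega>)) \<in> borel_measurable B"
    proof (rule borel_measurable_right_continuous_process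
        [where P = B and Z = "\<lambda>u \<omega>. real (N u \<omega>)" and g = "E r" and h = "\<lambda>\<omega>. \<omega>"])
      show "(\<lambda>\<omega>. real (N u \<omega>)) \<in> borel_measurable B" if "0 \<le> u" for u
        using N_B[OF that] by (rule measurable_compose) simp
      show "continuous (at_right u) (\<lambda>v. real (N v \<omega>))" if "\<omega> \<in> space B" "0 \<le> u" for \<omega> u
        using N that by (simp add: poisson_process_def space_B)
    qed (use E_nonneg E_B[OF that] in auto)
    \<comment> \<open>The random-time lemma concerns real-valued processes; the floor leads back to
      natural numbers.\<close>
    then have "(\<lambda>\<omega>. \<lfloor>real (N (E r \<omega>) \<omega>)\<rfloor>) \<in> measurable B (count_space UNIV)"
      by (rule measurable_compose[OF _ measurable_real_floor])
    then have "(\<lambda>\<omega>. nat \<lfloor>real (N (E r \<omega>) \<omega>)\<rfloor>) \<in> measurable B (count_space UNIV)"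
      by (rule measurable_compose) simp
    then show ?thesis by simp
  qed
  have E_M: "E r \<in> borel_measurable M" if "0 \<le> r" for r
    using measurable_mono[of borel borel B M] E_B[OF that] B_events space_B by auto
  have E_sq: "integrable M (\<lambda>\<omega>. (E r \<omega>)\<^sup>2)" if "0 \<le> r" for r
    using inverse_subordinator_square_integrable[OF D f1] E_M[OF that] by (simp add: E_def)
  have E_int: "integrable M (E r)" if "0 \<le> r" for r
    using square_integrable_imp_integrable[OF E_M E_sq] that by simp
  have X_indep: "indep_set (generated_events M borel X {1..}) (sets B)"
    unfolding sets_B by fact
  \<comment> \<open>The case \<open>q = r\<close> gives second moments and hence the variance; the
    covariance uses the times \<open>s\<close> and \<open>t\<close>.\<close>
  have product: "has_bochner_integral M (\<lambda>\<omega>. Y r \<omega> * Y q \<omega>)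
      (rate * expectation (\<lambda>\<omega>. (X 1 \<omega>)\<^sup>2) * expectation (E q)
        + rate\<^sup>2 * (expectation (X 1))\<^sup>2 * expectation (\<lambda>\<omega>. E r \<omega> * E q \<omega>))"
    and mean: "has_bochner_integral M (Y r) (rate * expectation (E r) * expectation (X 1))"
    if "0 \<le> q" "q \<le> r" for q r
  proof -
    have r: "0 \<le> r" using that by simp
    \<comment> \<open>The square is the product moment with both times equal to
      \<open>p\<close>.\<close>
    have K_sq: "integrable M (\<lambda>\<omega>. (real (N (E p \<omega>) \<omega>))\<^sup>2)" if "0 \<le> p" for p
      using time_changed_poisson_product_moment[where E = E, OF N rate NE_indep E_nonneg that that E_sq E_sq] that
      by (simp add: has_bochner_integral_iff power2_eq_square)
    have K_mean: "has_bochner_integral M (\<lambda>\<omega>. real (N (E p \<omega>) \<omega>)) (rate * expectation (E p))"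
      if "0 \<le> p" for p
      using time_changed_poisson_moment[where E = E, OF N rate NE_indep E_nonneg that that E_sq E_sq] that
      by simp
    have mono: "AE \<omega> in M. E q \<omega> \<le> E r \<omega>"
      unfolding E_def by (rule inverse_subordinator_AE_mono[OF D f1 that(2)])
    \<comment> \<open>Almost sure monotonicity of the inverse in its level turns the minimum into
      the value at \<open>q\<close>.\<close>
    have "expectation (\<lambda>\<omega>. min (E r \<omega>) (E q \<omega>)) = expectation (E q)"
      using mono E_M[OF r] E_M[OF that(1)] by (intro integral_cong_AE) (auto elim!: eventually_mono)
    then have K_prod: "has_bochner_integral M (\<lambda>\<omega>. real (N (E r \<omega>) \<omega>) * real (N (E q \<omega>) \<omega>))
        (rate * expectation (E q) + rate\<^sup>2 * expectation (\<lambda>\<omega>. E r \<omega> * E q \<omega>))"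
      using time_changed_poisson_product_moment
        [where E = E, OF N rate NE_indep E_nonneg that(1) r E_sq[OF that(1)] E_sq[OF r]] by simp
    have NE_M: "(\<lambda>\<omega>. N (E p \<omega>) \<omega>) \<in> measurable M (count_space UNIV)" if "0 \<le> p" for p
      using measurable_mono[of "count_space UNIV" "count_space UNIV" B M] NE_B[OF that] B_events space_B
      by auto
    note [measurable] = NE_M[OF r] NE_M[OF that(1)]
    \<comment> \<open>Since Poisson paths are nondecreasing, the order of the random times passes to
      the counts almost surely.\<close>
    have K_min: "expectation (\<lambda>\<omega>. real (min (N (E r \<omega>) \<omega>) (N (E q \<omega>) \<omega>))) = rate * expectation (E q)"
    proof -
      have "expectation (\<lambda>\<omega>. real (min (N (E r \<omega>) \<omega>) (N (E q \<omega>) \<omega>))) = expectation (\<lambda>\<omega>. real (N (E q \<omega>) \<omega>))"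
      proof (rule integral_cong_AE)
        show "AE \<omega> in M. real (min (N (E r \<omega>) \<omega>) (N (E q \<omega>) \<omega>)) = real (N (E q \<omega>) \<omega>)"
          using mono AE_space
          by eventually_elim (auto dest: poisson_process_mono[OF N _ E_nonneg] simp: min_def)
      qed measurable
      then show ?thesis
        using K_mean[OF that(1)] by (simp add: has_bochner_integral_iff)
    qed
    note random_sum = X assms(12) X_sq X_indep space_B NE_B[OF r] NE_B[OF that(1)] K_sq[OF r] K_sq[OF that(1)]
    have Y: "Y p = (\<lambda>\<omega>. \<Sum>i = 1..N (E p \<omega>) \<omega>. X i \<omega>)" for p
      by (simp add: \<open>Y = gfcpp N E X\<close> gfcpp_def fun_eq_iff)
    show "has_bochner_integral M (Y r) (rate * expectation (E r) * expectation (X 1))"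
      using random_sum_moment[OF random_sum] K_mean[OF r] by (simp add: Y has_bochner_integral_iff)
    \<comment> \<open>The term \<open>rate * expectation (E q)\<close> times the squared jump mean
      enters negatively through the jump variance and positively through \<open>K_prod\<close>. It
      cancels, leaving the second moment of a jump.\<close>
    show "has_bochner_integral M (\<lambda>\<omega>. Y r \<omega> * Y q \<omega>)
      (rate * expectation (\<lambda>\<omega>. (X 1 \<omega>)\<^sup>2) * expectation (E q)
        + rate\<^sup>2 * (expectation (X 1))\<^sup>2 * expectation (\<lambda>\<omega>. E r \<omega> * E q \<omega>))"
      using random_sum_product_moment[OF random_sum] K_prod
      unfolding Y K_min by (simp add: has_bochner_integral_iff algebra_simps)
  qed
  have t: "0 \<le> t" using assms(16,17) by simp
  have E_mult: "integrable M (\<lambda>\<omega>. E t \<omega> * E s \<omega>)"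
    using E_M E_sq t assms(16) by (intro integrable_mult_square) auto
  have Y_int: "integrable M (Y t)" "integrable M (Y s)"
    and Y_mean: "expectation (Y t) = rate * expectation (E t) * expectation (X 1)"
      "expectation (Y s) = rate * expectation (E s) * expectation (X 1)"
    using mean[OF t order_refl] mean[OF assms(16) order_refl] by (auto simp: has_bochner_integral_iff)
  have Y_sq: "integrable M (\<lambda>\<omega>. (Y t \<omega>)\<^sup>2)"
    and Y_sq_mean: "expectation (\<lambda>\<omega>. (Y t \<omega>)\<^sup>2) =
      rate * expectation (\<lambda>\<omega>. (X 1 \<omega>)\<^sup>2) * expectation (E t)
        + rate\<^sup>2 * (expectation (X 1))\<^sup>2 * expectation (\<lambda>\<omega>. (E t \<omega>)\<^sup>2)"
    using product[OF t order_refl] by (auto simp: has_bochner_integral_iff power2_eq_square)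
  have var: "variance (Y t) =
       rate * expectation (E t) * expectation (\<lambda>\<omega>. (X 1 \<omega>)\<^sup>2)
       + rate\<^sup>2 * (expectation (X 1))\<^sup>2 * variance (E t)"
    unfolding variance_eq[OF Y_int(1) Y_sq] variance_eq[OF E_int[OF t] E_sq[OF t]]
    unfolding Y_sq_mean Y_mean(1)
    by (simp add: algebra_simps power2_eq_square)
  have Y_prod: "integrable M (\<lambda>\<omega>. Y t \<omega> * Y s \<omega>)"
    and Y_prod_mean: "expectation (\<lambda>\<omega>. Y t \<omega> * Y s \<omega>) =
      rate * expectation (\<lambda>\<omega>. (X 1 \<omega>)\<^sup>2) * expectation (E s)
        + rate\<^sup>2 * (expectation (X 1))\<^sup>2 * expectation (\<lambda>\<omega>. E t \<omega> * E s \<omega>)"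
    using product[OF assms(16,17)] by (auto simp: has_bochner_integral_iff)
  have cov: "covariance M (Y t) (Y s) =
       rate * expectation (\<lambda>\<omega>. (X 1 \<omega>)\<^sup>2) * expectation (E s)
       + rate\<^sup>2 * (expectation (X 1))\<^sup>2 * covariance M (E t) (E s)"
    unfolding covariance_eq[OF Y_int Y_prod] covariance_eq[OF E_int[OF t] E_int[OF assms(16)] E_mult]
      Y_prod_mean Y_mean
    by (simp add: algebra_simps power2_eq_square)
  show ?thesis
    using E_int[OF t] E_sq[OF t] Y_int(1) Y_sq Y_mean(1) var cov by blast
qed

end
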